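(* Let $\mathbb{F}$ be a field such that $\operatorname{char}\mathbb{F}\neq 3$ and $\mathbb{F}$ contains a primitive cube root of unity $\omega$. Then the graphs $\Gamma_O^{\mathcal{N}_3}(P_8(\mathbb{F}))$ and $\Gamma_O^{\mathcal{N}_3}(M_3(\mathbb{F}))$ are isomorphic.
   Context: Let $\mu=\frac{1-\omega^2}{3}$. The pseudo-octonion algebra $P_8(\mathbb{F})$ is the $8$-dimensional space $\mathfrak{sl}_3(\mathbb{F})$ of traceless $3\times3$ matrices over $\mathbb{F}$ with the multiplication $x*y=\mu xy+(1-\mu)yx-\frac{\operatorname{tr}(xy)}{3}I$, where $xy$ is the usual matrix product and $I$ is the identity matrix. $M_3(\mathbb{F})$ is the algebra of $3\times 3$ matrices with the usual product, and $\mathcal{N}_3$ is the set of nilpotent matrices in $M_3(\mathbb{F})$ (so $\mathcal{N}_3\subseteq\mathfrak{sl}_3(\mathbb{F})$). For an algebra $\mathcal{A}$ over $\mathbb{F}$, the orthogonality graph $\Gamma_O(\mathcal{A})$ is the undirected graph whose vertices are the lines $[a]=\mathbb{F}a$ with $a$ a two-sided zero divisor of $\mathcal{A}$ (a nonzero element that is both a left and a right zero divisor), two distinct vertices $[a],[b]$ being adjacent if and only if both products of $a$ and $b$ (in either order, in $\mathcal{A}$) are zero. $\Gamma_O^{\mathcal{N}_3}(\mathcal{A})$, for $\mathcal{A}=P_8(\mathbb{F})$ or $M_3(\mathbb{F})$, is the induced subgraph of $\Gamma_O(\mathcal{A})$ on the vertex set $\mathbb{P}(\mathcal{N}_3)=\{[x]\mid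 x\in\mathcal{N}_3\setminus\{0\}\}$. *)

theory Defs
  imports
    "HOL-Analysis.Determinants"
    "HOL-Computational_Algebra.Computational_Algebra"
    "Graph_Theory.Graph_Theory"
begin

definition primitive_root_of_unity :: "nat \<Rightarrow> 'a::field \<Rightarrow> bool" where
  "primitive_root_of_unity n w \<longleftrightarrow> 0 < n \<and> w ^ n = 1 \<and> (\<forall>k. 0 < k \<and> k < n \<longrightarrow> w ^ k \<noteq> 1)"


section \<open>The orthogonality graph of an algebra\<close>

text \<open>
  An algebra is given by its underlying space \<open>V\<close>, its scalar multiplication \<open>scl\<close> and its
  product \<open>m\<close>; no associativity, commutativity or unit is assumed.
\<close>

definition left_zero_divisor :: "'v::zero set \<Rightarrow> ('v \<Rightarrow> 'v \<Rightarrow> 'v) \<Rightarrow> 'v \<Rightarrow> bool" where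
  "left_zero_divisor V m a \<longleftrightarrow> a \<in> V \<and> a \<noteq> 0 \<and> (\<exists>b\<in>V. b \<noteq> 0 \<and> m a b = 0)"

definition right_zero_divisor :: "'v::zero set \<Rightarrow> ('v \<Rightarrow> 'v \<Rightarrow> 'v) \<Rightarrow> 'v \<Rightarrow> bool" where
  "right_zero_divisor V m a \<longleftrightarrow> a \<in> V \<and> a \<noteq> 0 \<and> (\<exists>b\<in>V. b \<noteq> 0 \<and> m b a = 0)"

definition two_sided_zero_divisors :: "'v::zero set \<Rightarrow> ('v \<Rightarrow> 'v \<Rightarrow> 'v) \<Rightarrow> 'v set" where
  "two_sided_zero_divisors V m = {a. left_zero_divisor V m a \<and> right_zero_divisor V m a}"

definition line :: "('k \<Rightarrow> 'v \<Rightarrow> 'v) \<Rightarrow> 'v \<Rightarrow> 'v set" where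
  "line scl a = range (\<lambda>c. scl c a)"

text \<open>
  Following the convention of \<open>Graph_Theory\<close>, an undirected graph is a symmetric digraph: an edge
  between two vertices is represented by the two arcs joining them.
\<close>

definition orthogonality_graph ::
  "('k \<Rightarrow> 'v \<Rightarrow> 'v) \<Rightarrow> 'v::zero set \<Rightarrow> ('v \<Rightarrow> 'v \<Rightarrow> 'v) \<Rightarrow> ('v set, 'v set \<times> 'v set) pre_digraph" where
  "orthogonality_graph scl V m = with_proj
     \<lparr> pverts = line scl ` two_sided_zero_divisors V m,
       parcs = {(line scl a, line scl b) | a b.
         a \<in> two_sided_zero_divisors V m \<and> b \<in> two_sided_zero_divisors V m \<and>
         line scl a \<noteq> line scl b \<and> m a b = 0 \<and> m b a = 0} \<rparr>"

lemma wf_digraph_orthogonality_graph: "wf_digraph (orthogonality_graph scl V m)"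
  by unfold_locales (auto simp: orthogonality_graph_def)

lemma symmetric_orthogonality_graph: "symmetric (orthogonality_graph scl V m)"
  by (auto simp: orthogonality_graph_def symmetric_def sym_def)

lemma loopfree_digraph_orthogonality_graph: "loopfree_digraph (orthogonality_graph scl V m)"
proof -
  interpret wf_digraph "orthogonality_graph scl V m"
    by (rule wf_digraph_orthogonality_graph)
  show ?thesis
    by unfold_locales (auto simp: orthogonality_graph_def)
qed


section \<open>The algebras of \<open>3 \<times> 3\<close> matrices\<close>

definition mscale :: "'a::field \<Rightarrow> 'a^3^3 \<Rightarrow> 'a^3^3" where
  "mscale c A = (\<chi> i j. c * A $ i $ j)"

text \<open>
  The class operations \<open>*\<close> and \<open>^\<close> act componentwise on matrices, so powers are taken
  with respect to the matrix product \<open>**\<close>.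
\<close>

definition nilpotent_matrices :: "('a::field^3^3) set" where
  "nilpotent_matrices = {A. \<exists>n. (((**) A) ^^ n) (mat 1) = 0}"

definition traceless_matrices :: "('a::field^3^3) set" where
  "traceless_matrices = {A. trace A = 0}"

definition po_mu :: "'a::field \<Rightarrow> 'a" where
  "po_mu \<omega> = (1 - \<omega>\<^sup>2) / 3"

definition po_mult :: "'a::field \<Rightarrow> 'a^3^3 \<Rightarrow> 'a^3^3 \<Rightarrow> 'a^3^3" where
  "po_mult \<omega> x y =
     mscale (po_mu \<omega>) (x ** y) + mscale (1 - po_mu \<omega>) (y ** x) - mscale (trace (x ** y) / 3) (mat 1)"

lemma trace_mscale: "trace (mscale c A) = c * trace A"
  by (simp add: trace_def mscale_def sum_distrib_left)

lemma po_mult_traceless: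
  fixes \<omega> :: "'a::field"
  assumes "(3::'a) \<noteq> 0"
  shows "po_mult \<omega> x y \<in> traceless_matrices"
  using assms
  by (simp add: traceless_matrices_def po_mult_def trace_add trace_sub trace_mscale trace_I
      trace_mul_sym[of y x] algebra_simps)

definition P8_graph :: "'a::field \<Rightarrow> (('a^3^3) set, ('a^3^3) set \<times> ('a^3^3) set) pre_digraph" where
  "P8_graph \<omega> = orthogonality_graph mscale traceless_matrices (po_mult \<omega>)"

definition M3_graph :: "(('a::field^3^3) set, ('a^3^3) set \<times> ('a^3^3) set) pre_digraph" where
  "M3_graph = orthogonality_graph mscale UNIV (**)"

definition proj_nilpotent :: "('a::field^3^3) set set" where
  "proj_nilpotent = line mscale ` (nilpotent_matrices - {0})"

text \<open>
  \<open>G \<restriction> S\<close> is the induced subgraph on \<open>S\<close>; its vertex set is \<open>S\<close> itself. Every nonzero nilpotent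
  matrix is a two-sided zero divisor of both algebras: if \<open>x\<^sup>3 = 0\<close>, then both products of \<open>x\<close> with
  \<open>x\<^sup>2\<close> (or with \<open>x\<close> itself if \<open>x\<^sup>2 = 0\<close>) vanish.
\<close>

definition P8_nilpotent_graph ::
  "'a::field \<Rightarrow> (('a^3^3) set, ('a^3^3) set \<times> ('a^3^3) set) pre_digraph" where
  "P8_nilpotent_graph \<omega> = P8_graph \<omega> \<restriction> proj_nilpotent"

definition M3_nilpotent_graph ::
  "(('a::field^3^3) set, ('a^3^3) set \<times> ('a^3^3) set) pre_digraph" where
  "M3_nilpotent_graph = M3_graph \<restriction> proj_nilpotent"

end

theory Submission
  imports Defs
begin

text \<open>
  On nilpotent matrices the two orthogonality relations coincide, so the graphs are in fact equal.
  If \<open>x * y = y * x = 0\<close> in the pseudo-octonion algebra, subtracting the two equations gives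
  \<open>(2 \<mu> - 1) (x y - y x) = 0\<close>, where \<open>3 (2 \<mu> - 1)\<^sup>2 = -1\<close>; hence \<open>x y = y x = (tr (x y) / 3) I\<close>,
  and this scalar matrix is zero because \<open>x\<close> is singular.

  That nilpotent matrices are traceless follows from Cayley--Hamilton,
  \<open>A\<^sup>3 = t A\<^sup>2 - s A\<close>: if \<open>s \<noteq> 0\<close>, then \<open>A\<close> is a multiple of \<open>A\<^sup>2\<close>, hence of every power of
  \<open>A\<close>, so \<open>A = 0\<close>; if \<open>s = 0 \<noteq> t\<close>, then likewise \<open>A\<^sup>2 = 0\<close>, contradicting \<open>tr (A\<^sup>2) = t\<^sup>2 - 2 s\<close>.
\<close>

no_notation fps_nth (infixl \<open>$\<close> 75)

lemma mscale_0_left [simp]: "mscale 0 A = 0"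
  by (simp add: mscale_def vec_eq_iff)

lemma mscale_0_right [simp]: "mscale c 0 = 0"
  by (simp add: mscale_def vec_eq_iff)

lemma mscale_1 [simp]: "mscale 1 A = A"
  by (simp add: mscale_def vec_eq_iff)

lemma mscale_eq_0_iff [simp]: "mscale c A = 0 \<longleftrightarrow> c = 0 \<or> A = 0"
  by (auto simp: mscale_def vec_eq_iff)

lemma mscale_mscale: "mscale c (mscale d A) = mscale (c * d) A"
  by (simp add: mscale_def vec_eq_iff)

lemma mscale_mult_left: "mscale c A ** B = mscale c (A ** B)"
  by (simp add: mscale_def vec_eq_iff matrix_matrix_mult_def sum_distrib_left mult_ac)

lemma mscale_mult_right: "A ** mscale c B = mscale c (A ** B)"
  by (simp add: mscale_def vec_eq_iff matrix_matrix_mult_def sum_distrib_left mult_ac)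

lemma matrix_diff_ldistrib: "A ** (B - C) = A ** B - A ** C"
  for A :: "'a::ring_1^'n^'m"
  by (simp add: matrix_matrix_mult_def vec_eq_iff right_diff_distrib sum_subtractf)

lemma det_mscale_mat_1: "det (mscale c (mat 1)) = c ^ 3"
  by (simp add: det_3 mscale_def mat_def power3_eq_cube)

lemma matrix_power_mscale:
  "(((**) (mscale c A)) ^^ n) (mat 1) = mscale (c ^ n) ((((**) A) ^^ n) (mat 1))"
  by (induction n) (simp_all add: mscale_mult_left mscale_mult_right mscale_mscale mult_ac)

lemma nilpotent_mscale: "A \<in> nilpotent_matrices \<Longrightarrow> mscale c A \<in> nilpotent_matrices"
  unfolding nilpotent_matrices_def by (auto simp: matrix_power_mscale)

lemma det_nilpotent:
  assumes "A \<in> nilpotent_matrices"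
  shows "det A = 0"
proof -
  obtain n where n: "(((**) A) ^^ n) (mat 1) = 0"
    using assms by (auto simp: nilpotent_matrices_def)
  have "det ((((**) A) ^^ n) (mat 1)) = det A ^ n"
    by (induction n) (simp_all add: det_mul)
  moreover have "det (0 :: 'a^3^3) = 0"
    by (simp add: det_3)
  ultimately show ?thesis
    using n by simp
qed

text \<open>Substituting the equation into itself \<open>k\<close> times puts the
  \<open>k\<close>-th power of \<open>A\<close> to the left of \<open>B\<close>, and some power of
  \<open>A\<close> vanishes. The factor \<open>C\<close> leaves room for scalars and polynomials in
  \<open>A\<close>.\<close>

lemma nilpotent_absorb_eq_0:
  assumes "A \<in> nilpotent_matrices" and "B = A ** B ** C"
  shows "B = 0"
proof -
  obtain n where n: "(((**) A) ^^ n) (mat 1) = 0"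
    using assms by (auto simp: nilpotent_matrices_def)
  have "\<exists>D. B = (((**) A) ^^ k) (mat 1) ** B ** D" for k
  proof (induction k)
    case 0
    show ?case
      by (rule exI[of _ "mat 1"]) simp
  next
    case (Suc k)
    then obtain D where "B = (((**) A) ^^ k) (mat 1) ** B ** D"
      by blast
    then have "B = A ** ((((**) A) ^^ k) (mat 1) ** B ** D) ** C"
      using assms(2) by simp
    then show ?case
      by (intro exI[of _ "D ** C"]) (simp add: matrix_mul_assoc)
  qed
  then show ?thesis
    using n by (metis times0_left)
qed

text \<open>The sum of the principal 2 by 2 minors, which is the linear coefficient of the
  characteristic polynomial.\<close>

definition minor_sum :: "'a::field^3^3 \<Rightarrow> 'a" where
  "minor_sum A = A$1$1 * A$2$2 - A$1$2 * A$2$1 + (A$1$1 * A$3$3 - A$1$3 * A$3$1)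
    + (A$2$2 * A$3$3 - A$2$3 * A$3$2)"

lemma cayley_hamilton_3:
  fixes A :: "'a::field^3^3"
  shows "A ** A ** A = mscale (trace A) (A ** A) - mscale (minor_sum A) A + mscale (det A) (mat 1)"
  unfolding vec_eq_iff forall_3
  by (simp add: matrix_matrix_mult_def mscale_def mat_def trace_def sum_3 det_3 minor_sum_def
      algebra_simps)

lemma trace_square_3:
  fixes A :: "'a::field^3^3"
  shows "trace (A ** A) = trace A ^ 2 - 2 * minor_sum A"
  by (simp add: matrix_matrix_mult_def trace_def sum_3 minor_sum_def power2_eq_square algebra_simps)

lemma trace_nilpotent:
  fixes A :: "'a::field^3^3"
  assumes A: "A \<in> nilpotent_matrices"
  shows "trace A = 0"
proof -
  let ?t = "trace A" and ?s = "minor_sum A"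
  have ch: "A ** A ** A = mscale ?t (A ** A) - mscale ?s A"
    using cayley_hamilton_3[of A] det_nilpotent[OF A] by simp
  have s: "?s = 0"
  proof (rule ccontr)
    assume s0: "?s \<noteq> 0"
    \<comment> \<open>Cayley--Hamilton solved for its linear term and factored, so that after
      division by \<open>?s\<close> the absorption lemma applies with \<open>B\<close> equal to
      \<open>A\<close>.\<close>
    have "mscale ?s A = A ** A ** (mscale ?t (mat 1) - A)"
      using ch by (simp add: matrix_diff_ldistrib mscale_mult_right algebra_simps)
    then have "mscale (inverse ?s) (mscale ?s A)
        = A ** A ** mscale (inverse ?s) (mscale ?t (mat 1) - A)"
      by (simp add: mscale_mult_right)
    then have "A = A ** A ** mscale (inverse ?s) (mscale ?t (mat 1) - A)"
      using s0 by (simp add: mscale_mscale)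
    then have "A = 0"
      by (rule nilpotent_absorb_eq_0[OF A])
    then show False
      using s0 by (simp add: minor_sum_def)
  qed
  show ?thesis
  proof (rule ccontr)
    assume t0: "?t \<noteq> 0"
    have "mscale (inverse ?t) (A ** (A ** A)) = A ** A"
      using ch s t0 by (simp add: matrix_mul_assoc mscale_mscale)
    \<comment> \<open>The scalar becomes a right factor, to fit the absorption lemma with
      \<open>B\<close> equal to \<open>A ** A\<close>.\<close>
    then have "A ** A = A ** (A ** A) ** mscale (inverse ?t) (mat 1)"
      by (simp add: mscale_mult_right)
    then have "A ** A = 0"
      by (rule nilpotent_absorb_eq_0[OF A])
    then show False
      using trace_square_3[of A] s t0 by (simp add: trace_def)
  qed
qed

lemma po_mult_orthogonal_iff:
  fixes \<omega> :: "'a::field"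
  assumes three: "(3::'a) \<noteq> 0" and w: "1 + \<omega> + \<omega>\<^sup>2 = 0" and x: "x \<in> nilpotent_matrices"
  shows "po_mult \<omega> x y = 0 \<and> po_mult \<omega> y x = 0 \<longleftrightarrow> x ** y = 0 \<and> y ** x = 0"
proof
  assume "x ** y = 0 \<and> y ** x = 0"
  then show "po_mult \<omega> x y = 0 \<and> po_mult \<omega> y x = 0"
    by (simp add: po_mult_def trace_def)
next
  define m where "m = po_mu \<omega>"
  define t where "t = trace (x ** y) / 3"
  assume "po_mult \<omega> x y = 0 \<and> po_mult \<omega> y x = 0"
  then have xy: "mscale m (x ** y) + mscale (1 - m) (y ** x) = mscale t (mat 1)"
    and yx: "mscale m (y ** x) + mscale (1 - m) (x ** y) = mscale t (mat 1)"
    by (simp_all add: po_mult_def m_def t_def trace_mul_sym[of y x])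
  have m3: "3 * m = 1 - \<omega>\<^sup>2"
    using three by (simp add: m_def po_mu_def)
  have "3 * (3 * (2 * m - 1)\<^sup>2 + 1) = 0"
    using m3 w by algebra
  then have m0: "2 * m - 1 \<noteq> 0"
    using three by (auto simp: power2_eq_square)
  have "mscale (2 * m - 1) (x ** y - y ** x) = 0"
  proof -
    have "mscale (2 * m - 1) (x ** y - y ** x)
        = (mscale m (x ** y) + mscale (1 - m) (y ** x)) - (mscale m (y ** x) + mscale (1 - m) (x ** y))"
      by (simp add: vec_eq_iff mscale_def algebra_simps)
    then show ?thesis
      unfolding xy yx by simp
  qed
  then have comm: "x ** y = y ** x"
    using m0 by simp
  \<comment> \<open>Once the products agree, the weights \<open>m\<close> and \<open>1 - m\<close>
    add up to 1.\<close>
  have scalar: "x ** y = mscale t (mat 1)"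
    using xy unfolding comm vec_eq_iff mscale_def by (simp add: algebra_simps)
  have "t ^ 3 = 0"
    using det_mul[of x y] det_nilpotent[OF x] unfolding scalar det_mscale_mat_1 by simp
  then show "x ** y = 0 \<and> y ** x = 0"
    using comm scalar by simp
qed

text \<open>Being a scalar multiple of itself, \<open>a\<close> lies on its own line, hence is a
  multiple of the nilpotent matrix spanning that line. Any representative of a vertex may thus be
  used.\<close>

lemma nilpotent_of_line:
  assumes "line mscale a \<in> proj_nilpotent"
  shows "a \<in> nilpotent_matrices"
proof -
  obtain x where x: "x \<in> nilpotent_matrices" "line mscale a = line mscale x"
    using assms by (auto simp: proj_nilpotent_def)
  have "a \<in> line mscale a"
    unfolding line_def by (metis mscale_1 rangeI)
  then show ?thesis
    using x by (auto simp: line_def intro: nilpotent_mscale)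
qed

lemma two_sided_zero_divisorsI:
  "\<lbrakk>a \<in> V; b \<in> V; a \<noteq> 0; b \<noteq> 0; m a b = 0; m b a = 0\<rbrakk> \<Longrightarrow> a \<in> two_sided_zero_divisors V m"
  by (auto simp: two_sided_zero_divisors_def left_zero_divisor_def right_zero_divisor_def)

text \<open>Two nonzero elements whose products vanish witness each other as two-sided zero
  divisors. Arcs can then be compared across algebras without reference to their zero
  divisors.\<close>

lemma arcs_orthogonality_graph:
  "arcs (orthogonality_graph scl V m) = {(line scl a, line scl b) | a b. a \<in> V \<and> b \<in> V \<and>
     a \<noteq> 0 \<and> b \<noteq> 0 \<and> line scl a \<noteq> line scl b \<and> m a b = 0 \<and> m b a = 0}"
proof -
  have "a \<in> two_sided_zero_divisors V m \<and> b \<in> two_sided_zero_divisors V m \<and> m a b = 0 \<and> m b a = 0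
      \<longleftrightarrow> a \<in> V \<and> b \<in> V \<and> a \<noteq> 0 \<and> b \<noteq> 0 \<and> m a b = 0 \<and> m b a = 0" for a b
    using two_sided_zero_divisorsI[of a V b m] two_sided_zero_divisorsI[of b V a m]
    by (auto simp: two_sided_zero_divisors_def left_zero_divisor_def)
  then show ?thesis
    unfolding orthogonality_graph_def by simp blast
qed

lemma tail_orthogonality_graph: "tail (orthogonality_graph scl V m) = fst"
  by (simp add: orthogonality_graph_def)

lemma head_orthogonality_graph: "head (orthogonality_graph scl V m) = snd"
  by (simp add: orthogonality_graph_def)

text \<open>Both induced subgraphs have vertex set \<open>proj_nilpotent\<close> by construction, so
  only the arcs between nilpotent lines need comparing.\<close>

lemma P8_nilpotent_graph_eq_M3_nilpotent_graph:
  fixes \<omega> :: "'a::field"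
  assumes "(3::'a) \<noteq> 0" and "1 + \<omega> + \<omega>\<^sup>2 = 0"
  shows "P8_nilpotent_graph \<omega> = M3_nilpotent_graph"
proof -
  let ?N = "proj_nilpotent :: ('a^3^3) set set"
  have iff: "a \<in> traceless_matrices \<and> b \<in> traceless_matrices \<and> po_mult \<omega> a b = 0 \<and> po_mult \<omega> b a = 0
      \<longleftrightarrow> a ** b = 0 \<and> b ** a = 0"
    if "line mscale a \<in> ?N" "line mscale b \<in> ?N" for a b
    using that[THEN nilpotent_of_line] po_mult_orthogonal_iff[OF assms, of a b]
    by (simp add: traceless_matrices_def trace_nilpotent)
  have "e \<in> arcs (P8_graph \<omega>) \<longleftrightarrow> e \<in> arcs M3_graph" if "e \<in> ?N \<times> ?N" for e
    using that unfolding P8_graph_def M3_graph_def arcs_orthogonality_graph mem_Collect_eq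
    \<comment> \<open>The same representatives \<open>a\<close> and \<open>b\<close> witness the arc
      in both graphs.\<close>
    by (intro ex_cong1) (metis (no_types, lifting) SigmaD1 SigmaD2 UNIV_I iff)
  then have "{e \<in> arcs (P8_graph \<omega>). fst e \<in> ?N \<and> snd e \<in> ?N}
      = {e \<in> arcs M3_graph. fst e \<in> ?N \<and> snd e \<in> ?N}"
    by (auto simp: mem_Times_iff)
  then show ?thesis
    unfolding P8_nilpotent_graph_def M3_nilpotent_graph_def induce_subgraph_def
    by (simp add: P8_graph_def M3_graph_def tail_orthogonality_graph head_orthogonality_graph)
qed

lemma digraph_iso_refl:
  assumes "wf_digraph G"
  shows "digraph_iso G G"
proof -
  \<comment> \<open>The last two fields prescribe the head and tail maps of the image graph, so they
    are those of \<open>G\<close> rather than \<open>id\<close>.\<close>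
  let ?id = "\<lparr>iso_verts = id, iso_arcs = id, iso_head = head G, iso_tail = tail G\<rparr>"
  have "pre_digraph.digraph_isomorphism G ?id"
    using assms by (simp add: pre_digraph.digraph_isomorphism_def)
  moreover have "G = app_iso ?id G"
    by (simp add: app_iso_def)
  ultimately show ?thesis
    unfolding digraph_iso_def by blast
qed

theorem lemma5p5:
  fixes \<omega> :: "'a::field"
  assumes "CHAR('a) \<noteq> 3"
    and "primitive_root_of_unity 3 \<omega>"
  shows "digraph_iso (P8_nilpotent_graph \<omega>) (M3_nilpotent_graph :: (('a^3^3) set, ('a^3^3) set \<times> ('a^3^3) set) pre_digraph)"
proof -
  \<comment> \<open>If 3 were zero, the characteristic would divide the prime 3; the value 1 is
    impossible in a field and 3 is excluded by assumption.\<close>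
  have "CHAR('a) \<noteq> 1"
    by simp
  moreover have "CHAR('a) = 1 \<or> CHAR('a) = 3" if "CHAR('a) dvd 3"
  proof -
    have "prime (3::nat)"
      by simp
    then show ?thesis
      using that unfolding prime_nat_iff by blast
  qed
  ultimately have three: "(3::'a) \<noteq> 0"
    using assms(1) of_nat_eq_0_iff_char_dvd[of 3, where 'a = 'a] by auto
  have "\<omega> ^ 3 = 1" and "\<omega> \<noteq> 1"
    using assms(2) by (auto simp: primitive_root_of_unity_def dest: spec[of _ 1])
  \<comment> \<open>This is the factorization of \<open>\<omega> ^ 3 - 1\<close>.\<close>
  then have "(\<omega> - 1) * (1 + \<omega> + \<omega>\<^sup>2) = 0"
    by algebra
  then have "1 + \<omega> + \<omega>\<^sup>2 = 0"
    using \<open>\<omega> \<noteq> 1\<close> by simp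
  then have "P8_nilpotent_graph \<omega> = M3_nilpotent_graph"
    using three by (intro P8_nilpotent_graph_eq_M3_nilpotent_graph)
  moreover have "wf_digraph (P8_nilpotent_graph \<omega>)"
    unfolding P8_nilpotent_graph_def P8_graph_def
    by (intro wf_digraph.wellformed_induce_subgraph wf_digraph_orthogonality_graph)
  ultimately show ?thesis
    using digraph_iso_refl by metis
qed

end
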